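(* Let $(\Omega,\Sigma)$ be a measurable space and let $X$ be a real Banach space. Let $M:\Sigma\to b(X)$ be a map for which there is a symmetric set $\Gamma\subseteq X^*$ (i.e. $-x^*\in\Gamma$ whenever $x^*\in\Gamma$) separating the points of $X$ such that $s(x^*,M)\in {\rm ca}(\Sigma)$ for every $x^*\in\Gamma$. Then $M$ admits a control measure if and only if $\Sigma\setminus\mathcal{N}(M)$ has the countable chain condition (CCC).
   Context: $b(X)$ is the family of all bounded non-empty subsets of $X$. For $C\in b(X)$ and $x^*\in X^*$, $s(x^*,C):=\sup\{x^*(x): x\in C\}$; for a map $M:\Sigma\to b(X)$, $s(x^*,M):\Sigma\to\mathbb{R}$ is defined by $s(x^*,M)(A):=s(x^*,M(A))$. ${\rm ca}(\Sigma)$ is the set of all countably additive real-valued (signed, finite) measures on $\Sigma$, and ${\rm ca}^+(\Sigma)$ is the subset of finite non-negative measures. For $A\in\Sigma$, $\Sigma_A:=\{B\in\Sigma: B\subseteq A\}$. For a map $M:\Sigma\to b(X)$, $\mathcal{N}(M):=\{A\in\Sigma: M(B)=\{0\}\text{ for all }B\in\Sigma_A\}$. A measure $\mu\in{\rm ca}^+(\Sigma)$ is a control measure of $M$ if $M(A)=\{0\}$ for every $A\in\Sigma$ with $\mu(A)=0$. A set $\mathcal{A}\subseteq\Sigma$ has the countable chain condition (CCC) if there is no uncountable subset of $\mathcal{A}$ consisting of pairwise disjoint sets. *)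

theory Defs
  imports "HOL-Analysis.Analysis"
begin

definition bdd_nonempty_sets :: "'b::real_normed_vector set set" where
  "bdd_nonempty_sets = {C. bounded C \<and> C \<noteq> {}}"

text \<open>The supremum is the one of the conditionally complete lattice \<^typ>\<open>real\<close>; it is only
  meaningful for \<open>C \<in> bdd_nonempty_sets\<close>.\<close>

definition support_fun :: "('b::real_normed_vector \<Rightarrow>\<^sub>L real) \<Rightarrow> 'b set \<Rightarrow> real" where
  "support_fun f C = (SUP x\<in>C. blinfun_apply f x)"

definition support_map ::
    "('b::real_normed_vector \<Rightarrow>\<^sub>L real) \<Rightarrow> ('a set \<Rightarrow> 'b set) \<Rightarrow> 'a set \<Rightarrow> real" where
  "support_map f M = (\<lambda>A. support_fun f (M A))"

definition symmetric_functionals :: "('b::real_normed_vector \<Rightarrow>\<^sub>L real) set \<Rightarrow> bool" where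
  "symmetric_functionals \<Gamma> \<longleftrightarrow> (\<forall>f\<in>\<Gamma>. - f \<in> \<Gamma>)"

definition separates_points :: "('b::real_normed_vector \<Rightarrow>\<^sub>L real) set \<Rightarrow> bool" where
  "separates_points \<Gamma> \<longleftrightarrow>
     (\<forall>x y. x \<noteq> y \<longrightarrow> (\<exists>f\<in>\<Gamma>. blinfun_apply f x \<noteq> blinfun_apply f y))"

text \<open>Set functions on \<open>\<Sigma>\<close> are represented by total functions on \<^typ>\<open>'a set\<close> whose values
  outside \<open>\<Sigma>\<close> are irrelevant. Signed measures are not available as a type; the predicate
  \<^const>\<open>countably_additive\<close> of the library concerns \<open>ennreal\<close>-valued functions only.
  The value at the empty set is automatically 0, by applying the condition to the constant
  sequence of empty sets.\<close>

definition ca :: "'a set set \<Rightarrow> ('a set \<Rightarrow> real) set" where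
  "ca \<Sigma> = {\<mu>. \<forall>A :: nat \<Rightarrow> 'a set. range A \<subseteq> \<Sigma> \<longrightarrow> disjoint_family A \<longrightarrow> (\<Union>i. A i) \<in> \<Sigma>
                \<longrightarrow> (\<lambda>i. \<mu> (A i)) sums \<mu> (\<Union>i. A i)}"

definition ca_pos :: "'a set set \<Rightarrow> ('a set \<Rightarrow> real) set" where
  "ca_pos \<Sigma> = {\<mu> \<in> ca \<Sigma>. \<forall>A\<in>\<Sigma>. 0 \<le> \<mu> A}"

definition null_sets_of :: "'a set set \<Rightarrow> ('a set \<Rightarrow> 'b::real_normed_vector set) \<Rightarrow> 'a set set" where
  "null_sets_of \<Sigma> M = {A \<in> \<Sigma>. \<forall>B\<in>\<Sigma>. B \<subseteq> A \<longrightarrow> M B = {0}}"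

definition control_measure ::
    "'a set set \<Rightarrow> ('a set \<Rightarrow> 'b::real_normed_vector set) \<Rightarrow> ('a set \<Rightarrow> real) \<Rightarrow> bool" where
  "control_measure \<Sigma> M \<mu> \<longleftrightarrow> \<mu> \<in> ca_pos \<Sigma> \<and> (\<forall>A\<in>\<Sigma>. \<mu> A = 0 \<longrightarrow> M A = {0})"

definition ccc :: "'a set set \<Rightarrow> bool" where
  "ccc \<A> \<longleftrightarrow> \<not> (\<exists>\<B>\<subseteq>\<A>. uncountable \<B> \<and> disjoint \<B>)"

text \<open>The elements of \<^const>\<open>ca_pos\<close> are the finite measures of the library.\<close>

lemma ca_empty:
  assumes "\<mu> \<in> ca \<Sigma>" and "{} \<in> \<Sigma>"
  shows "\<mu> {} = 0"
proof -
  have "(\<lambda>i::nat. \<mu> {}) sums \<mu> {}"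
    using assms unfolding ca_def
    by (auto dest!: spec[of _ "\<lambda>_::nat. {}"] simp: disjoint_family_on_def)
  then show ?thesis
    using sums_summable summable_const_iff by blast
qed

lemma ca_pos_iff_finite_measure:
  assumes "sigma_algebra \<Omega> \<Sigma>"
  shows "\<mu> \<in> ca_pos \<Sigma> \<longleftrightarrow>
    (\<exists>N. finite_measure N \<and> space N = \<Omega> \<and> sets N = \<Sigma> \<and> (\<forall>A\<in>\<Sigma>. measure N A = \<mu> A))"
proof
  interpret sigma_algebra \<Omega> \<Sigma> by fact
  assume mu: "\<mu> \<in> ca_pos \<Sigma>"
  then have ca: "\<mu> \<in> ca \<Sigma>" and nn: "\<And>A. A \<in> \<Sigma> \<Longrightarrow> 0 \<le> \<mu> A"
    by (auto simp: ca_pos_def)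
  define N where "N = measure_of \<Omega> \<Sigma> (\<lambda>A. ennreal (\<mu> A))"
  have sp: "space N = \<Omega>" and st: "sets N = \<Sigma>"
    unfolding N_def using space_closed by (auto simp: sigma_sets_eq)
  have em: "emeasure N A = ennreal (\<mu> A)" if "A \<in> \<Sigma>" for A
    unfolding N_def
  proof (rule emeasure_measure_of_sigma)
    show "sigma_algebra \<Omega> \<Sigma>" by fact
    show "positive \<Sigma> (\<lambda>A. ennreal (\<mu> A))"
      using ca_empty[OF ca] by (simp add: positive_def)
    show "countably_additive \<Sigma> (\<lambda>A. ennreal (\<mu> A))"
    proof (rule countably_additiveI)
      fix A :: "nat \<Rightarrow> 'a set"
      assume A: "range A \<subseteq> \<Sigma>" "disjoint_family A" "(\<Union>i. A i) \<in> \<Sigma>"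
      then have "(\<lambda>i. \<mu> (A i)) sums \<mu> (\<Union>i. A i)"
        using ca by (auto simp: ca_def)
      then show "(\<Sum>i. ennreal (\<mu> (A i))) = ennreal (\<mu> (\<Union>i. A i))"
        using nn A by (intro suminf_ennreal_eq) auto
    qed
    show "A \<in> \<Sigma>" by fact
  qed
  have "finite_measure N"
    by (rule finite_measureI) (simp add: sp em)
  moreover have "\<forall>A\<in>\<Sigma>. measure N A = \<mu> A"
    using em nn by (simp add: measure_def)
  ultimately show "\<exists>N. finite_measure N \<and> space N = \<Omega> \<and> sets N = \<Sigma> \<and> (\<forall>A\<in>\<Sigma>. measure N A = \<mu> A)"
    using sp st by blast
next
  assume "\<exists>N. finite_measure N \<and> space N = \<Omega> \<and> sets N = \<Sigma> \<and> (\<forall>A\<in>\<Sigma>. measure N A = \<mu> A)"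
  then obtain N where N: "finite_measure N" "sets N = \<Sigma>" "\<And>A. A \<in> \<Sigma> \<Longrightarrow> measure N A = \<mu> A"
    by blast
  interpret finite_measure N by fact
  have "(\<lambda>i. \<mu> (A i)) sums \<mu> (\<Union>i. A i)"
    if A: "range A \<subseteq> \<Sigma>" "disjoint_family A" "(\<Union>i. A i) \<in> \<Sigma>" for A :: "nat \<Rightarrow> 'a set"
  proof -
    have "(\<lambda>i. measure N (A i)) sums measure N (\<Union>i. A i)"
      using A N(2) by (intro finite_measure_UNION) auto
    moreover have "\<And>i. A i \<in> \<Sigma>" using A by auto
    ultimately show ?thesis using N(3) A(3) by simp
  qed
  moreover have "\<forall>A\<in>\<Sigma>. 0 \<le> \<mu> A"
    using N(3) measure_nonneg by metis
  ultimately show "\<mu> \<in> ca_pos \<Sigma>"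
    by (simp add: ca_pos_def ca_def)
qed

end

(* Each support functional s(f, M), f in \<Gamma>, is a signed measure; by symmetry and separation of
   \<Gamma> the null sets of M are exactly the common null sets of these measures. As in the
   Halmos-Savage theorem, the countable chain condition yields a countable subfamily of \<Gamma> with
   the same common null sets, and a weighted sum of the variations of the corresponding measures
   is a control measure. *)

theory Submission
  imports Defs
begin

section \<open>Exhaustion under the countable chain condition\<close>

text \<open>Zorn's lemma for the disjoint subfamilies ordered by inclusion: a member of
  \<open>\<A>\<close> missing the union of a maximal one could be adjoined to it.\<close>

lemma maximal_disjoint_subfamily:
  assumes "{} \<notin> \<A>"
  obtains \<B> where "\<B> \<subseteq> \<A>" "disjoint \<B>" "\<And>A. A \<in> \<A> \<Longrightarrow> A \<inter> \<Union>\<B> \<noteq> {}"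
proof -
  let ?D = "{\<B>. \<B> \<subseteq> \<A> \<and> disjoint \<B>}"
  have "\<exists>\<B>\<in>?D. \<forall>\<C>\<in>?D. \<B> \<subseteq> \<C> \<longrightarrow> \<C> = \<B>"
  proof (rule subset_Zorn')
    fix C assume C: "subset.chain ?D C"
    have "disjoint (\<Union>C)"
    proof (rule disjointI)
      fix a b assume "a \<in> \<Union>C" "b \<in> \<Union>C" and ne: "a \<noteq> b"
      then obtain X Y where "X \<in> C" "Y \<in> C" "a \<in> X" "b \<in> Y" by blast
      then obtain Z where "Z \<in> C" "a \<in> Z" "b \<in> Z"
        using C unfolding subset_chain_def by (meson subsetD)
      moreover have "disjoint Z"
        using C \<open>Z \<in> C\<close> unfolding subset_chain_def by blast
      ultimately show "a \<inter> b = {}"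
        using ne by (blast dest: disjointD)
    qed
    then show "\<Union>C \<in> ?D"
      using C unfolding subset_chain_def by blast
  qed
  then obtain \<B> where D: "\<B> \<in> ?D" and max: "\<forall>\<C>\<in>?D. \<B> \<subseteq> \<C> \<longrightarrow> \<C> = \<B>" ..
  then have \<B>: "\<B> \<subseteq> \<A>" "disjoint \<B>" by simp_all
  have "A \<inter> \<Union>\<B> \<noteq> {}" if A: "A \<in> \<A>" for A
  proof
    assume dis: "A \<inter> \<Union>\<B> = {}"
    have "disjoint (insert A \<B>)"
      using \<B>(2) dis by (auto simp: pairwise_insert disjnt_def)
    then have "insert A \<B> = \<B>"
      using A \<B>(1) by (intro max[rule_format]) auto
    \<comment> \<open>Now \<open>A\<close> lies inside \<open>\<Union>\<B>\<close> and is disjoint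
      from it, hence empty; this is where \<open>{} \<notin> \<A>\<close> enters.\<close>
    then have "A \<in> \<B>" by (metis insertI1)
    then have "A = {}" using dis by blast
    then show False using A assms by simp
  qed
  then show thesis
    using that \<B> by blast
qed

text \<open>The form in which the chain condition is applied: it makes the maximal disjoint family
  countable, so that unions over it stay in \<Sigma> and in sigma-ideals.\<close>

lemma ccc_exhaustion:
  assumes "ccc \<S>" "{} \<notin> \<S>" "\<A> \<subseteq> \<S>"
  obtains \<B> where "\<B> \<subseteq> \<A>" "countable \<B>" "disjoint \<B>" "\<And>A. A \<in> \<A> \<Longrightarrow> A \<inter> \<Union>\<B> \<noteq> {}"
proof -
  from assms(2,3) have "{} \<notin> \<A>" by blast
  then obtain \<B> where \<B>: "\<B> \<subseteq> \<A>" "disjoint \<B>" "\<And>A. A \<in> \<A> \<Longrightarrow> A \<inter> \<Union>\<B> \<noteq> {}"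
    by (rule maximal_disjoint_subfamily) (rule that; assumption)
  moreover have "countable \<B>"
    using assms(1,3) \<B>(1,2) unfolding ccc_def by blast
  ultimately show thesis using that by blast
qed

section \<open>Sigma-ideals and reduction to countably many of them\<close>

definition sigma_ideal :: "'a set set \<Rightarrow> 'a set set \<Rightarrow> bool" where
  "sigma_ideal \<Sigma> I \<longleftrightarrow> I \<subseteq> \<Sigma> \<and> {} \<in> I \<and> (\<forall>A\<in>I. \<forall>B\<in>\<Sigma>. B \<subseteq> A \<longrightarrow> B \<in> I)
     \<and> (\<forall>E :: nat \<Rightarrow> 'a set. range E \<subseteq> I \<longrightarrow> \<Union>(range E) \<in> I)"

lemma sigma_ideal_subset:
  "sigma_ideal \<Sigma> I \<Longrightarrow> A \<in> I \<Longrightarrow> B \<in> \<Sigma> \<Longrightarrow> B \<subseteq> A \<Longrightarrow> B \<in> I"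
  unfolding sigma_ideal_def by blast

lemma sigma_ideal_Union:
  assumes I: "sigma_ideal \<Sigma> I" and \<B>: "countable \<B>" "\<B> \<subseteq> I"
  shows "\<Union>\<B> \<in> I"
proof (cases "\<B> = {}")
  case True
  then show ?thesis using I by (simp add: sigma_ideal_def)
next
  case False
  \<comment> \<open>The enumeration may repeat members, which covers finite families; only the empty
    family had to be treated apart.\<close>
  then have "range (from_nat_into \<B>) = \<B>"
    using \<B>(1) by (rule range_from_nat_into)
  then show ?thesis
    using I \<B>(2) unfolding sigma_ideal_def by metis
qed

lemma sigma_ideal_Un:
  assumes "sigma_ideal \<Sigma> I" "A \<in> I" "B \<in> I"
  shows "A \<union> B \<in> I"
  using sigma_ideal_Union[OF assms(1), of "{A, B}"] assms(2,3) by simp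

lemma sigma_ideal_common:
  assumes "sigma_algebra \<Omega> \<Sigma>" "\<And>f. f \<in> \<Gamma> \<Longrightarrow> sigma_ideal \<Sigma> (I f)"
  shows "sigma_ideal \<Sigma> {A\<in>\<Sigma>. \<forall>f\<in>\<Gamma>. A \<in> I f}"
proof -
  interpret sigma_algebra \<Omega> \<Sigma> by fact
  let ?N = "{A\<in>\<Sigma>. \<forall>f\<in>\<Gamma>. A \<in> I f}"
  have "\<Union>(range E) \<in> ?N" if E: "range E \<subseteq> ?N" for E :: "nat \<Rightarrow> 'a set"
  proof -
    have "range E \<subseteq> \<Sigma>" using E by blast
    then have "\<Union>(range E) \<in> \<Sigma>" by blast
    moreover have "\<Union>(range E) \<in> I f" if "f \<in> \<Gamma>" for f
      using assms(2)[OF that] that E by (intro sigma_ideal_Union) auto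
    ultimately show ?thesis by simp
  qed
  moreover have "{} \<in> ?N"
    using assms(2) by (simp add: sigma_ideal_def)
  moreover have "B \<in> ?N" if "A \<in> ?N" "B \<in> \<Sigma>" "B \<subseteq> A" for A B
    using that sigma_ideal_subset[OF assms(2)] by blast
  ultimately show ?thesis
    unfolding sigma_ideal_def by blast
qed

text \<open>The Halmos--Savage argument: an exhaustion by sets on which a single ideal \<open>I f\<close> already
  determines the common ideal. Such a set exists inside every set outside \<open>I f\<close>: remove a
  maximal disjoint family of members of \<open>I f\<close> that are not in the common ideal.\<close>

lemma countable_subfamily_same_common_ideal:
  fixes \<Gamma> :: "'f set"
  assumes sa: "sigma_algebra \<Omega> \<Sigma>"
    and I: "\<And>f. f \<in> \<Gamma> \<Longrightarrow> sigma_ideal \<Sigma> (I f)"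
    and ccc: "ccc (\<Sigma> - {A\<in>\<Sigma>. \<forall>f\<in>\<Gamma>. A \<in> I f})"
  obtains \<Gamma>' where "countable \<Gamma>'" "\<Gamma>' \<subseteq> \<Gamma>"
    "{A\<in>\<Sigma>. \<forall>f\<in>\<Gamma>'. A \<in> I f} = {A\<in>\<Sigma>. \<forall>f\<in>\<Gamma>. A \<in> I f}"
proof -
  interpret sigma_algebra \<Omega> \<Sigma> by fact
  define N where "N = {A\<in>\<Sigma>. \<forall>f\<in>\<Gamma>. A \<in> I f}"
  have N: "sigma_ideal \<Sigma> N"
    unfolding N_def by (rule sigma_ideal_common[OF sa I])
  have cccN: "ccc (\<Sigma> - N)" using ccc by (simp add: N_def)
  have e: "{} \<notin> \<Sigma> - N" using N by (simp add: sigma_ideal_def)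
  \<comment> \<open>The sets, themselves outside \<open>N\<close>, on which a single index
    \<open>f\<close> already decides membership in \<open>N\<close>.\<close>
  define \<A> where "\<A> = {A \<in> \<Sigma> - N. \<exists>f\<in>\<Gamma>. \<forall>C\<in>I f. C \<subseteq> A \<longrightarrow> C \<in> N}"
  have dense: "\<exists>A\<in>\<A>. A \<subseteq> E" if E: "E \<in> \<Sigma> - N" for E
  proof -
    obtain f where f: "f \<in> \<Gamma>" "E \<notin> I f" using E by (auto simp: N_def)
    note If = I[OF f(1)]
    have sub: "{C \<in> I f - N. C \<subseteq> E} \<subseteq> \<Sigma> - N"
      using If by (auto simp: sigma_ideal_def)
    \<comment> \<open>A maximal disjoint family of bad pieces of \<open>E\<close>: those that
      \<open>I f\<close> counts as null although \<open>N\<close> does not.\<close>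
    obtain \<C> where \<C>: "\<C> \<subseteq> {C \<in> I f - N. C \<subseteq> E}" "countable \<C>"
      and max: "\<And>C. C \<in> {C \<in> I f - N. C \<subseteq> E} \<Longrightarrow> C \<inter> \<Union>\<C> \<noteq> {}"
      by (rule ccc_exhaustion[OF cccN e sub]) (rule that; assumption)
    have U: "\<Union>\<C> \<in> I f"
      using \<C> by (intro sigma_ideal_Union[OF If]) auto
    then have US: "\<Union>\<C> \<in> \<Sigma>" using If by (auto simp: sigma_ideal_def)
    \<comment> \<open>Only a member of \<open>I f\<close> has been removed from \<open>E\<close>,
      and \<open>E\<close> itself is outside \<open>I f\<close>.\<close>
    have "E - \<Union>\<C> \<notin> I f"
    proof
      assume "E - \<Union>\<C> \<in> I f"
      then have "(E - \<Union>\<C>) \<union> \<Union>\<C> \<in> I f"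
        using U by (rule sigma_ideal_Un[OF If])
      then have "E \<in> I f"
        using E by (intro sigma_ideal_subset[OF If, of _ E]) auto
      with f(2) show False by contradiction
    qed
    \<comment> \<open>A bad piece of the remainder would miss \<open>\<Union>\<C>\<close>, against
      maximality.\<close>
    moreover have "C \<in> N" if "C \<in> I f" "C \<subseteq> E - \<Union>\<C>" for C
      using max[of C] that by blast
    moreover have "E - \<Union>\<C> \<in> \<Sigma>" using E US by blast
    moreover from this have "E - \<Union>\<C> \<notin> N"
      using \<open>E - \<Union>\<C> \<notin> I f\<close> f(1) by (auto simp: N_def)
    ultimately have "E - \<Union>\<C> \<in> \<A>"
      using f(1) unfolding \<A>_def by blast
    then show ?thesis by blast
  qed
  have sub: "\<A> \<subseteq> \<Sigma> - N" by (auto simp: \<A>_def)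
  obtain \<B> where \<B>: "\<B> \<subseteq> \<A>" "countable \<B>"
    and max: "\<And>A. A \<in> \<A> \<Longrightarrow> A \<inter> \<Union>\<B> \<noteq> {}"
    by (rule ccc_exhaustion[OF cccN e sub]) (rule that; assumption)
  have "\<forall>B\<in>\<B>. \<exists>f\<in>\<Gamma>. \<forall>C\<in>I f. C \<subseteq> B \<longrightarrow> C \<in> N"
    using \<B>(1) by (auto simp: \<A>_def)
  then obtain g where g: "\<And>B. B \<in> \<B> \<Longrightarrow> g B \<in> \<Gamma>"
    "\<And>B C. B \<in> \<B> \<Longrightarrow> C \<in> I (g B) \<Longrightarrow> C \<subseteq> B \<Longrightarrow> C \<in> N"
    by metis
  have BS: "B \<in> \<Sigma>" if "B \<in> \<B>" for B
    using that \<B>(1) by (auto simp: \<A>_def)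
  have UB: "\<Union>\<B> \<in> \<Sigma>"
    using \<B>(2) BS by (intro countable_Union) auto
  \<comment> \<open>Split \<open>A\<close> along \<open>\<B>\<close>: inside each \<open>B\<close>
    the index \<open>g B\<close> decides, and a remainder outside \<open>N\<close> would contain, by
    \<open>dense\<close>, a member of \<open>\<A>\<close> missing
    \<open>\<Union>\<B>\<close>.\<close>
  have "A \<in> N" if A: "A \<in> \<Sigma>" "\<And>h. h \<in> g ` \<B> \<Longrightarrow> A \<in> I h" for A
  proof -
    have "A \<inter> B \<in> N" if B: "B \<in> \<B>" for B
      using A(1) BS[OF B] by (intro g(2)[OF B] sigma_ideal_subset[OF I[OF g(1)[OF B]] A(2)] imageI B) auto
    then have "(\<Union>B\<in>\<B>. A \<inter> B) \<in> N"
      using \<B>(2) by (intro sigma_ideal_Union[OF N]) auto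
    moreover have "A - \<Union>\<B> \<in> N"
    proof (rule ccontr)
      assume "A - \<Union>\<B> \<notin> N"
      then obtain A' where "A' \<in> \<A>" "A' \<subseteq> A - \<Union>\<B>"
        using dense[of "A - \<Union>\<B>"] A(1) UB by auto
      then show False using max by blast
    qed
    ultimately have "(\<Union>B\<in>\<B>. A \<inter> B) \<union> (A - \<Union>\<B>) \<in> N"
      by (rule sigma_ideal_Un[OF N])
    also have "(\<Union>B\<in>\<B>. A \<inter> B) \<union> (A - \<Union>\<B>) = A" by blast
    finally show ?thesis .
  qed
  then have sub: "{A\<in>\<Sigma>. \<forall>f\<in>g ` \<B>. A \<in> I f} \<subseteq> {A\<in>\<Sigma>. \<forall>f\<in>\<Gamma>. A \<in> I f}"
    by (auto simp: N_def)
  have "countable (g ` \<B>)" and g\<Gamma>: "g ` \<B> \<subseteq> \<Gamma>"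
    using \<B>(2) g(1) by auto
  moreover have "{A\<in>\<Sigma>. \<forall>f\<in>g ` \<B>. A \<in> I f} = {A\<in>\<Sigma>. \<forall>f\<in>\<Gamma>. A \<in> I f}"
    using sub g\<Gamma> by blast
  ultimately show thesis by (rule that)
qed

section \<open>Signed measures\<close>

lemma zero_in_ca_pos: "(\<lambda>_. 0) \<in> ca_pos \<Sigma>"
  by (simp add: ca_pos_def ca_def)

text \<open>For a signed measure these are the null sets of its total variation. Quantifying over
  subsets excludes sets whose measure vanishes by cancellation.\<close>

definition null_ideal :: "'a set set \<Rightarrow> ('a set \<Rightarrow> real) \<Rightarrow> 'a set set" where
  "null_ideal \<Sigma> \<nu> = {A \<in> \<Sigma>. \<forall>B\<in>\<Sigma>. B \<subseteq> A \<longrightarrow> \<nu> B = 0}"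

text \<open>The positive part of the Jordan decomposition, by its supremum formula;
  \<open>ca_bounded\<close> makes the supremum meaningful.\<close>

definition pos_variation :: "'a set set \<Rightarrow> ('a set \<Rightarrow> real) \<Rightarrow> 'a set \<Rightarrow> real" where
  "pos_variation \<Sigma> \<nu> A = (SUP B\<in>{B\<in>\<Sigma>. B \<subseteq> A}. \<nu> B)"

context
  fixes \<Omega> :: "'a set" and \<Sigma> :: "'a set set"
  assumes sa: "sigma_algebra \<Omega> \<Sigma>"
begin

interpretation sigma_algebra \<Omega> \<Sigma> by (fact sa)

lemma ca_sums:
  assumes "\<nu> \<in> ca \<Sigma>" "\<And>i :: nat. A i \<in> \<Sigma>" "disjoint_family A"
  shows "(\<lambda>i. \<nu> (A i)) sums \<nu> (\<Union>i. A i)"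
proof -
  have "range A \<subseteq> \<Sigma>" using assms(2) by blast
  moreover from this have "(\<Union>i. A i) \<in> \<Sigma>" by blast
  ultimately show ?thesis using assms(1,3) by (simp add: ca_def)
qed

lemma ca_Un:
  assumes \<nu>: "\<nu> \<in> ca \<Sigma>" and "A \<in> \<Sigma>" "B \<in> \<Sigma>" "A \<inter> B = {}"
  shows "\<nu> (A \<union> B) = \<nu> A + \<nu> B"
proof -
  have "binaryset A B i \<in> \<Sigma>" for i
    using assms(2,3) by (simp add: binaryset_def)
  moreover have "disjoint_family (binaryset A B)"
    using assms(4) by (auto simp: disjoint_family_on_def binaryset_def)
  ultimately have "(\<lambda>i. \<nu> (binaryset A B i)) sums \<nu> (A \<union> B)"
    using ca_sums[OF \<nu>, of "binaryset A B"] by (simp add: UN_binaryset_eq)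
  moreover have "(\<lambda>i. \<nu> (binaryset A B i)) sums (\<nu> A + \<nu> B)"
    using ca_empty[OF \<nu>] by (intro binaryset_sums) auto
  ultimately show ?thesis by (rule sums_unique2)
qed

lemma ca_Diff:
  assumes "\<nu> \<in> ca \<Sigma>" "A \<in> \<Sigma>" "B \<in> \<Sigma>" "B \<subseteq> A"
  shows "\<nu> A = \<nu> (A - B) + \<nu> B"
proof -
  have "A = (A - B) \<union> B" using assms(4) by blast
  then show ?thesis using ca_Un[OF assms(1), of "A - B" B] assms(2,3) by auto
qed

lemma ca_uminus: "\<nu> \<in> ca \<Sigma> \<Longrightarrow> (\<lambda>A. - \<nu> A) \<in> ca \<Sigma>"
  unfolding ca_def by (auto intro: sums_minus)

lemma ca_pos_add:
  assumes "\<mu> \<in> ca_pos \<Sigma>" "\<nu> \<in> ca_pos \<Sigma>"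
  shows "(\<lambda>A. \<mu> A + \<nu> A) \<in> ca_pos \<Sigma>"
  using assms by (simp add: ca_pos_def ca_def sums_add)

lemma ca_pos_mono:
  assumes "\<mu> \<in> ca_pos \<Sigma>" "A \<in> \<Sigma>" "B \<in> \<Sigma>" "B \<subseteq> A"
  shows "\<mu> B \<le> \<mu> A"
  using ca_Diff[of \<mu> A B] assms by (auto simp: ca_pos_def)

text \<open>For closure under unions, cut a subset \<open>B\<close> of the union along
  \<open>disjointed E\<close>: each piece lies in some \<open>E i\<close> and has measure 0, and
  countable additivity sums the pieces.\<close>

lemma sigma_ideal_null_ideal:
  assumes \<nu>: "\<nu> \<in> ca \<Sigma>"
  shows "sigma_ideal \<Sigma> (null_ideal \<Sigma> \<nu>)"
proof -
  have "\<Union>(range E) \<in> null_ideal \<Sigma> \<nu>" if E: "range E \<subseteq> null_ideal \<Sigma> \<nu>" for E :: "nat \<Rightarrow> 'a set"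
  proof -
    have ES: "range E \<subseteq> \<Sigma>" using E by (auto simp: null_ideal_def)
    have "\<nu> B = 0" if B: "B \<in> \<Sigma>" "B \<subseteq> \<Union>(range E)" for B
    proof -
      have D: "B \<inter> disjointed E i \<in> \<Sigma>" for i
        using range_disjointed_sets[OF ES] B(1) by blast
      have "disjoint_family (\<lambda>i. B \<inter> disjointed E i)"
        using disjoint_family_disjointed[of E] by (fastforce simp: disjoint_family_on_def)
      then have "(\<lambda>i. \<nu> (B \<inter> disjointed E i)) sums \<nu> (\<Union>i. B \<inter> disjointed E i)"
        using D by (intro ca_sums[OF \<nu>])
      also have "(\<Union>i. B \<inter> disjointed E i) = B"
        using B(2) UN_disjointed_eq[of E] by blast
      finally have "(\<lambda>i. \<nu> (B \<inter> disjointed E i)) sums \<nu> B" .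
      moreover have "\<nu> (B \<inter> disjointed E i) = 0" for i
        using E D[of i] disjointed_subset[of E i] by (fastforce simp: null_ideal_def image_subset_iff)
      ultimately show ?thesis
        by (simp add: sums_0 sums_unique2)
    qed
    moreover have "\<Union>(range E) \<in> \<Sigma>" using ES by blast
    ultimately show ?thesis by (simp add: null_ideal_def)
  qed
  then show ?thesis
    using ca_empty[OF \<nu>] unfolding sigma_ideal_def null_ideal_def by auto
qed

text \<open>A set on which the measure is unbounded splits off a piece of absolute measure at least 1
  such that the measure is still unbounded on the remaining part; iterating this contradicts
  the convergence of the series over the pieces.\<close>

lemma ca_bounded:
  assumes \<nu>: "\<nu> \<in> ca \<Sigma>"
  obtains K where "\<And>A. A \<in> \<Sigma> \<Longrightarrow> \<bar>\<nu> A\<bar> \<le> K"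
proof -
  define bd where "bd E \<longleftrightarrow> (\<exists>K. \<forall>A\<in>\<Sigma>. A \<subseteq> E \<longrightarrow> \<bar>\<nu> A\<bar> \<le> K)" for E
  have bd_Un: "bd E" if "B \<in> \<Sigma>" "B \<subseteq> E" "E \<in> \<Sigma>" and bd: "bd B" "bd (E - B)" for B E
  proof -
    obtain K where K: "\<forall>A\<in>\<Sigma>. A \<subseteq> B \<longrightarrow> \<bar>\<nu> A\<bar> \<le> K"
      using bd(1) unfolding bd_def ..
    obtain L where L: "\<forall>A\<in>\<Sigma>. A \<subseteq> E - B \<longrightarrow> \<bar>\<nu> A\<bar> \<le> L"
      using bd(2) unfolding bd_def ..
    have "\<bar>\<nu> A\<bar> \<le> K + L" if A: "A \<in> \<Sigma>" "A \<subseteq> E" for A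
    proof -
      have "A = (A \<inter> B) \<union> (A - B)" by blast
      then have "\<nu> A = \<nu> (A \<inter> B) + \<nu> (A - B)"
        using ca_Un[OF \<nu>, of "A \<inter> B" "A - B"] A(1) \<open>B \<in> \<Sigma>\<close> by auto
      moreover have "\<bar>\<nu> (A \<inter> B)\<bar> \<le> K" using A \<open>B \<in> \<Sigma>\<close> by (intro K[rule_format]) auto
      moreover have "\<bar>\<nu> (A - B)\<bar> \<le> L" using A \<open>B \<in> \<Sigma>\<close> by (intro L[rule_format]) auto
      ultimately show ?thesis by linarith
    qed
    then show ?thesis unfolding bd_def by blast
  qed
  have split: "\<exists>E'. (E' \<in> \<Sigma> \<and> \<not> bd E') \<and> (E' \<subseteq> E \<and> 1 \<le> \<bar>\<nu> (E - E')\<bar>)"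
    if E: "E \<in> \<Sigma> \<and> \<not> bd E" for E
  proof -
    \<comment> \<open>The failing bound is \<open>\<bar>\<nu> E\<bar> + 1\<close>, chosen so that
      both \<open>B\<close> and \<open>E - B\<close> have absolute measure at least 1. Either may
      then be split off, and an unbounded one is kept.\<close>
    obtain B where B: "B \<in> \<Sigma>" "B \<subseteq> E" "\<bar>\<nu> E\<bar> + 1 < \<bar>\<nu> B\<bar>"
      using E unfolding bd_def by (meson not_le)
    have eq: "\<nu> E = \<nu> (E - B) + \<nu> B"
      using E B by (intro ca_Diff[OF \<nu>]) auto
    show ?thesis
    proof (cases "bd B")
      case False
      then show ?thesis using B eq by (intro exI[of _ B]) auto
    next
      case True
      then have "\<not> bd (E - B)" using bd_Un B E by blast
      moreover have "E - (E - B) = B" using B(2) by blast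
      ultimately show ?thesis using B E by (intro exI[of _ "E - B"]) auto
    qed
  qed
  have "bd \<Omega>"
  proof (rule ccontr)
    assume unb: "\<not> bd \<Omega>"
    \<comment> \<open>Dependent choice iterates \<open>split\<close> from \<Omega>; the pieces split
      off are the successive differences.\<close>
    have "\<exists>E. \<forall>n :: nat. (E n \<in> \<Sigma> \<and> \<not> bd (E n)) \<and> (E (Suc n) \<subseteq> E n \<and> 1 \<le> \<bar>\<nu> (E n - E (Suc n))\<bar>)"
      by (rule dependent_nat_choice) (use unb top split in blast)+
    then obtain E :: "nat \<Rightarrow> 'a set" where E: "\<And>n. E n \<in> \<Sigma>" "\<And>n. E (Suc n) \<subseteq> E n"
      "\<And>n. 1 \<le> \<bar>\<nu> (E n - E (Suc n))\<bar>" by blast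
    have anti: "E n \<subseteq> E m" if "m \<le> n" for m n
      using lift_Suc_antimono_le[of E, OF E(2) that] .
    have "disjoint_family (\<lambda>n. E n - E (Suc n))"
      unfolding disjoint_family_on_def
    proof (intro ballI impI)
      fix m n :: nat assume "m \<noteq> n"
      then consider "Suc m \<le> n" | "Suc n \<le> m" by linarith
      then show "(E m - E (Suc m)) \<inter> (E n - E (Suc n)) = {}"
        by cases (use anti in blast)+
    qed
    then have "(\<lambda>n. \<nu> (E n - E (Suc n))) sums \<nu> (\<Union>n. E n - E (Suc n))"
      using E(1) by (intro ca_sums[OF \<nu>]) auto
    then have "(\<lambda>n. \<nu> (E n - E (Suc n))) \<longlonglongrightarrow> 0"
      using sums_summable summable_LIMSEQ_zero by blast
    then have "\<forall>\<^sub>F n in sequentially. \<bar>\<nu> (E n - E (Suc n))\<bar> < 1"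
      by (auto dest!: tendstoD[where e = 1] simp: dist_real_def)
    then show False
      using E(3) by (auto simp: eventually_sequentially not_less[symmetric])
  qed
  then obtain K where "\<forall>A\<in>\<Sigma>. A \<subseteq> \<Omega> \<longrightarrow> \<bar>\<nu> A\<bar> \<le> K"
    unfolding bd_def ..
  then have "\<bar>\<nu> A\<bar> \<le> K" if "A \<in> \<Sigma>" for A
    using that sets_into_space by blast
  then show thesis by (rule that)
qed

section \<open>The positive variation is a finite measure\<close>

context
  fixes \<nu> :: "'a set \<Rightarrow> real"
  assumes \<nu>: "\<nu> \<in> ca \<Sigma>"
begin

lemma pos_variation_upper:
  assumes "B \<in> \<Sigma>" "B \<subseteq> A"
  shows "\<nu> B \<le> pos_variation \<Sigma> \<nu> A"
proof -
  obtain K where "\<And>A. A \<in> \<Sigma> \<Longrightarrow> \<bar>\<nu> A\<bar> \<le> K" using ca_bounded[OF \<nu>] by blast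
  then have "bdd_above (\<nu> ` {B\<in>\<Sigma>. B \<subseteq> A})"
    by (intro bdd_aboveI[of _ K]) (auto dest: abs_le_D1)
  then show ?thesis
    unfolding pos_variation_def using assms by (intro cSUP_upper) auto
qed

lemma pos_variation_least:
  assumes "\<And>B. B \<in> \<Sigma> \<Longrightarrow> B \<subseteq> A \<Longrightarrow> \<nu> B \<le> c"
  shows "pos_variation \<Sigma> \<nu> A \<le> c"
  unfolding pos_variation_def
  by (rule cSUP_least) (use assms in auto)

lemma pos_variation_nonneg: "0 \<le> pos_variation \<Sigma> \<nu> A"
  using pos_variation_upper[of "{}" A] ca_empty[OF \<nu>] by auto

lemma pos_variation_mono: "A \<subseteq> B \<Longrightarrow> pos_variation \<Sigma> \<nu> A \<le> pos_variation \<Sigma> \<nu> B"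
  by (rule pos_variation_least) (auto intro: pos_variation_upper)

text \<open>If \<open>C\<close> competes for \<open>A\<close> and \<open>D\<close> for
  \<open>B\<close>, then \<open>C \<union> D\<close> competes for \<open>A \<union> B\<close>. The
  suprema over \<open>C\<close> and \<open>D\<close> are taken one after the other.\<close>

lemma pos_variation_superadditive:
  assumes "A \<inter> B = {}"
  shows "pos_variation \<Sigma> \<nu> A + pos_variation \<Sigma> \<nu> B \<le> pos_variation \<Sigma> \<nu> (A \<union> B)"
proof -
  have "\<nu> C + \<nu> D \<le> pos_variation \<Sigma> \<nu> (A \<union> B)"
    if "C \<in> \<Sigma>" "C \<subseteq> A" "D \<in> \<Sigma>" "D \<subseteq> B" for C D
  proof -
    have "\<nu> C + \<nu> D = \<nu> (C \<union> D)"
      using that assms by (intro ca_Un[OF \<nu>, symmetric]) auto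
    also have "\<dots> \<le> pos_variation \<Sigma> \<nu> (A \<union> B)"
      using that by (intro pos_variation_upper) auto
    finally show ?thesis .
  qed
  then have "\<nu> C \<le> pos_variation \<Sigma> \<nu> (A \<union> B) - \<nu> D"
    if "C \<in> \<Sigma>" "C \<subseteq> A" "D \<in> \<Sigma>" "D \<subseteq> B" for C D
    using that by (simp add: le_diff_eq)
  then have "pos_variation \<Sigma> \<nu> A \<le> pos_variation \<Sigma> \<nu> (A \<union> B) - \<nu> D"
    if "D \<in> \<Sigma>" "D \<subseteq> B" for D
    using that by (intro pos_variation_least) auto
  then have "\<nu> D \<le> pos_variation \<Sigma> \<nu> (A \<union> B) - pos_variation \<Sigma> \<nu> A"
    if "D \<in> \<Sigma>" "D \<subseteq> B" for D
    using that by (simp add: le_diff_eq add.commute)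
  then have "pos_variation \<Sigma> \<nu> B \<le> pos_variation \<Sigma> \<nu> (A \<union> B) - pos_variation \<Sigma> \<nu> A"
    by (intro pos_variation_least) auto
  then show ?thesis by simp
qed

lemma pos_variation_ca_pos: "pos_variation \<Sigma> \<nu> \<in> ca_pos \<Sigma>"
proof -
  let ?p = "pos_variation \<Sigma> \<nu>"
  have "(\<lambda>i. ?p (A i)) sums ?p (\<Union>i. A i)"
    if A: "range A \<subseteq> \<Sigma>" "disjoint_family A" for A :: "nat \<Rightarrow> 'a set"
  proof -
    \<comment> \<open>Superadditivity bounds the partial sums, giving convergence and one
      inequality.\<close>
    have "(\<Sum>i<n. ?p (A i)) \<le> ?p (\<Union>i<n. A i)" for n
    proof (induction n)
      case 0
      then show ?case by (simp add: pos_variation_nonneg)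
    next
      case (Suc n)
      have "A i \<inter> A n = {}" if "i < n" for i
        using A(2) that by (simp add: disjoint_family_on_def)
      then have "(\<Union>i<n. A i) \<inter> A n = {}" by blast
      then have "?p (\<Union>i<n. A i) + ?p (A n) \<le> ?p ((\<Union>i<n. A i) \<union> A n)"
        by (rule pos_variation_superadditive)
      then show ?case
        using Suc by (simp add: lessThan_Suc Un_commute)
    qed
    then have le: "(\<Sum>i<n. ?p (A i)) \<le> ?p (\<Union>i. A i)" for n
      by (rule order_trans) (auto intro: pos_variation_mono)
    then have sm: "summable (\<lambda>i. ?p (A i))"
      by (intro summableI_nonneg_bounded pos_variation_nonneg)
    \<comment> \<open>The other inequality: cut a competitor \<open>B\<close> for the union into the
      pieces \<open>B \<inter> A i\<close>, each a competitor for \<open>A i\<close>.\<close>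
    have "\<nu> B \<le> (\<Sum>i. ?p (A i))" if B: "B \<in> \<Sigma>" "B \<subseteq> (\<Union>i. A i)" for B
    proof -
      have D: "B \<inter> A i \<in> \<Sigma>" for i using A(1) B(1) by blast
      have "disjoint_family (\<lambda>i. B \<inter> A i)"
        using A(2) by (fastforce simp: disjoint_family_on_def)
      then have "(\<lambda>i. \<nu> (B \<inter> A i)) sums \<nu> (\<Union>i. B \<inter> A i)"
        using D by (intro ca_sums[OF \<nu>])
      also have "(\<Union>i. B \<inter> A i) = B" using B(2) by blast
      finally have "(\<lambda>i. \<nu> (B \<inter> A i)) sums \<nu> B" .
      with pos_variation_upper[OF D] show ?thesis
        using summable_sums[OF sm] by (rule sums_le) blast
    qed
    then have "?p (\<Union>i. A i) \<le> (\<Sum>i. ?p (A i))"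
      by (rule pos_variation_least)
    moreover have "(\<Sum>i. ?p (A i)) \<le> ?p (\<Union>i. A i)"
      using sm le by (rule suminf_le_const)
    ultimately show ?thesis
      using summable_sums[OF sm] by (metis order.antisym)
  qed
  then show ?thesis
    by (auto simp: ca_pos_def ca_def pos_variation_nonneg)
qed

end

section \<open>Finite measures dominating countably many signed measures\<close>

lemma ca_pos_dominating:
  assumes \<nu>: "\<nu> \<in> ca \<Sigma>"
  obtains \<mu> where "\<mu> \<in> ca_pos \<Sigma>" "\<And>A. A \<in> \<Sigma> \<Longrightarrow> \<mu> A = 0 \<Longrightarrow> A \<in> null_ideal \<Sigma> \<nu>"
proof -
  let ?n = "\<lambda>A. - \<nu> A"
  \<comment> \<open>The total variation. Both summands are nonnegative, so both vanish with it and
    bound \<open>\<nu> B\<close> and \<open>- \<nu> B\<close> above by 0.\<close>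
  let ?m = "\<lambda>A. pos_variation \<Sigma> \<nu> A + pos_variation \<Sigma> ?n A"
  have n: "?n \<in> ca \<Sigma>" using \<nu> by (rule ca_uminus)
  have "\<nu> B = 0" if "?m A = 0" "B \<in> \<Sigma>" "B \<subseteq> A" for A B
    using that(1) pos_variation_nonneg[OF \<nu>, of A] pos_variation_nonneg[OF n, of A]
      pos_variation_upper[OF \<nu> that(2,3)] pos_variation_upper[OF n that(2,3)]
    by linarith
  moreover have "?m \<in> ca_pos \<Sigma>"
    using pos_variation_ca_pos[OF \<nu>] pos_variation_ca_pos[OF n] by (rule ca_pos_add)
  ultimately show thesis
    by (intro that[of ?m]) (auto simp: null_ideal_def)
qed

text \<open>A weighted sum of the measures works: its terms are nonnegative, so it vanishes only
  where all of them do.\<close>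

lemma ca_pos_seq_dominating:
  fixes m :: "nat \<Rightarrow> 'a set \<Rightarrow> real"
  assumes m: "\<And>n. m n \<in> ca_pos \<Sigma>"
  obtains \<mu> where "\<mu> \<in> ca_pos \<Sigma>" "\<And>A n. A \<in> \<Sigma> \<Longrightarrow> \<mu> A = 0 \<Longrightarrow> m n A = 0"
proof -
  \<comment> \<open>Dividing by \<open>1 + m n \<Omega>\<close> brings all values into [0, 1], also
    when \<open>m n \<Omega>\<close> is 0; the factor \<open>(1/2)^n\<close> then makes the series
    converge.\<close>
  define w where "w n A = (1/2)^n * (m n A / (1 + m n \<Omega>))" for n A
  define \<mu> where "\<mu> A = (\<Sum>n. w n A)" for A
  have nn: "0 \<le> m n A" if "A \<in> \<Sigma>" for n A
    using m that by (simp add: ca_pos_def)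
  have w0: "0 \<le> w n A" if "A \<in> \<Sigma>" for n A
    using nn[OF that, of n] nn[OF top, of n] by (simp add: w_def)
  have "m n A / (1 + m n \<Omega>) \<le> 1" if "A \<in> \<Sigma>" for n A
    using ca_pos_mono[OF m top that, of n] nn[OF top, of n] sets_into_space[OF that]
    by (simp add: divide_simps)
  then have w1: "w n A \<le> (1/2)^n" if "A \<in> \<Sigma>" for n A
    using that unfolding w_def by (intro mult_left_le) auto
  have geo: "summable (\<lambda>n. (1/2::real)^n)" by (rule summable_geometric) simp
  have sm: "summable (\<lambda>n. w n A)" if "A \<in> \<Sigma>" for A
    using w0[OF that] w1[OF that] by (intro summable_comparison_test'[OF geo, of 0]) simp
  have "(\<lambda>i. \<mu> (A i)) sums \<mu> (\<Union>i. A i)"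
    if A: "range A \<subseteq> \<Sigma>" "disjoint_family A" for A :: "nat \<Rightarrow> 'a set"
  proof -
    have AS: "A i \<in> \<Sigma>" for i using A(1) by blast
    have US: "(\<Union>i. A i) \<in> \<Sigma>" using A(1) by blast
    have ws: "(\<lambda>i. w n (A i)) sums w n (\<Union>i. A i)" for n
      unfolding w_def using m[of n] AS A(2)
      by (intro sums_mult sums_divide ca_sums) (auto simp: ca_pos_def)
    have bound: "norm (\<Sum>i<k. w n (A i)) \<le> (1/2)^n" for n k
    proof -
      have "(\<Sum>i<k. w n (A i)) \<le> (\<Sum>i. w n (A i))"
        using ws[of n] by (intro sum_le_suminf) (auto simp: sums_iff w0 AS)
      also have "\<dots> \<le> (1/2)^n"
        using ws[of n] w1[OF US, of n] by (simp add: sums_iff)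
      finally show ?thesis by (simp add: sum_nonneg w0 AS)
    qed
    \<comment> \<open>Tannery's theorem, with majorant \<open>(1/2)^n\<close>, exchanges the limit
      in \<open>k\<close> with the sum over \<open>n\<close>.\<close>
    have "(\<lambda>k. \<Sum>n. \<Sum>i<k. w n (A i)) \<longlonglongrightarrow> (\<Sum>n. w n (\<Union>i. A i))"
      by (rule tannerys_theorem[where M = "\<lambda>n. (1/2)^n", THEN conjunct2, THEN conjunct2])
        (use ws bound geo in \<open>auto simp: sums_def intro!: always_eventually\<close>)
    moreover have "(\<Sum>n. \<Sum>i<k. w n (A i)) = (\<Sum>i<k. \<mu> (A i))" for k
      unfolding \<mu>_def by (rule suminf_sum) (simp add: sm AS)
    ultimately show ?thesis by (simp add: sums_def \<mu>_def)
  qed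
  moreover have "0 \<le> \<mu> A" if "A \<in> \<Sigma>" for A
    unfolding \<mu>_def using sm[OF that] w0[OF that] by (rule suminf_nonneg)
  ultimately have "\<mu> \<in> ca_pos \<Sigma>"
    by (auto simp: ca_pos_def ca_def)
  moreover have "m n A = 0" if A: "A \<in> \<Sigma>" "\<mu> A = 0" for A n
  proof -
    have "w n A = 0"
      using A(2) sm[OF A(1)] w0[OF A(1)] unfolding \<mu>_def by (simp add: suminf_eq_zero_iff)
    then show ?thesis using nn[OF top, of n] by (simp add: w_def)
  qed
  ultimately show thesis using that by blast
qed

lemma ca_countable_family_dominating:
  fixes \<nu> :: "'f \<Rightarrow> 'a set \<Rightarrow> real"
  assumes "countable \<Gamma>" "\<And>f. f \<in> \<Gamma> \<Longrightarrow> \<nu> f \<in> ca \<Sigma>"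
  obtains \<mu> where "\<mu> \<in> ca_pos \<Sigma>"
    "\<And>A f. A \<in> \<Sigma> \<Longrightarrow> \<mu> A = 0 \<Longrightarrow> f \<in> \<Gamma> \<Longrightarrow> A \<in> null_ideal \<Sigma> (\<nu> f)"
proof (cases "\<Gamma> = {}")
  case True
  \<comment> \<open>With nothing to dominate the zero measure serves; \<open>from_nat_into\<close>
    below enumerates a nonempty family.\<close>
  then show thesis using that zero_in_ca_pos by blast
next
  case False
  have "\<exists>\<mu>. \<mu> \<in> ca_pos \<Sigma> \<and> (\<forall>A\<in>\<Sigma>. \<mu> A = 0 \<longrightarrow> A \<in> null_ideal \<Sigma> (\<nu> f))" if "f \<in> \<Gamma>" for f
    using ca_pos_dominating[OF assms(2)[OF that]] by metis
  then obtain m where m: "\<And>f. f \<in> \<Gamma> \<Longrightarrow> m f \<in> ca_pos \<Sigma>"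
    "\<And>f A. f \<in> \<Gamma> \<Longrightarrow> A \<in> \<Sigma> \<Longrightarrow> m f A = 0 \<Longrightarrow> A \<in> null_ideal \<Sigma> (\<nu> f)"
    by metis
  obtain \<mu> where \<mu>: "\<mu> \<in> ca_pos \<Sigma>"
    "\<And>A n. A \<in> \<Sigma> \<Longrightarrow> \<mu> A = 0 \<Longrightarrow> m (from_nat_into \<Gamma> n) A = 0"
    using ca_pos_seq_dominating[of "\<lambda>n. m (from_nat_into \<Gamma> n)"] m(1) from_nat_into[OF False]
    by metis
  have "A \<in> null_ideal \<Sigma> (\<nu> f)" if "A \<in> \<Sigma>" "\<mu> A = 0" "f \<in> \<Gamma>" for A f
    using m(2) \<mu>(2) that from_nat_into_surj[OF assms(1) that(3)] by metis
  then show thesis using that \<mu>(1) by blast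
qed

text \<open>Sums over finite subfamilies are bounded by the total mass, so the measures form a
  summable family, which has only countably many nonzero terms.\<close>

lemma ca_pos_disjoint_countable:
  assumes \<mu>: "\<mu> \<in> ca_pos \<Sigma>" and \<B>: "\<B> \<subseteq> \<Sigma>" "disjoint \<B>" "\<And>A. A \<in> \<B> \<Longrightarrow> \<mu> A \<noteq> 0"
  shows "countable \<B>"
proof -
  obtain N where N: "finite_measure N" "sets N = \<Sigma>" "\<And>A. A \<in> \<Sigma> \<Longrightarrow> measure N A = \<mu> A"
    using \<mu> unfolding ca_pos_iff_finite_measure[OF sa] by blast
  interpret N: finite_measure N by fact
  have "(\<Sum>A\<in>F. measure N A) \<le> measure N (space N)" if F: "finite F" "F \<subseteq> \<B>" for F
  proof -
    have "(\<Sum>A\<in>F. measure N A) = measure N (\<Union>A\<in>F. A)"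
      using F \<B>(1,2) N(2)
      by (intro N.finite_measure_finite_Union[symmetric])
        (auto simp: disjoint_family_on_def dest: disjointD)
    also have "\<dots> \<le> measure N (space N)" by (rule N.bounded_measure)
    finally show ?thesis .
  qed
  then have "(\<lambda>A. measure N A) summable_on \<B>"
    by (intro nonneg_bdd_above_summable_on bdd_aboveI) auto
  then have "countable {A\<in>\<B>. measure N A \<noteq> 0}"
    by (rule summable_countable_real)
  also have "{A\<in>\<B>. measure N A \<noteq> 0} = \<B>"
    using \<B>(1,3) N(3) by auto
  finally show ?thesis .
qed

end

section \<open>Control measures\<close>

lemma support_fun_singleton_zero: "support_fun f {0} = 0"
  by (simp add: support_fun_def)

text \<open>A vanishing supremum gives \<open>f x \<le> 0\<close> on \<open>C\<close>; applied to
  \<open>- f\<close> as well this gives \<open>f x = 0\<close> for all \<open>f\<close> in \<Gamma>,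
  and separation from the origin forces \<open>x = 0\<close>.\<close>

lemma support_fun_zeros_imp_singleton_zero:
  assumes C: "C \<in> bdd_nonempty_sets"
    and \<Gamma>: "symmetric_functionals \<Gamma>" "separates_points \<Gamma>"
    and zero: "\<And>f. f \<in> \<Gamma> \<Longrightarrow> support_fun f C = 0"
  shows "C = {0}"
proof -
  have le: "blinfun_apply f x \<le> 0" if "f \<in> \<Gamma>" "x \<in> C" for f x
  proof -
    have "bounded (blinfun_apply f ` C)"
      using C by (intro bounded_linear_image blinfun.bounded_linear_right)
        (simp add: bdd_nonempty_sets_def)
    then have "blinfun_apply f x \<le> support_fun f C"
      unfolding support_fun_def using that(2)
      by (intro cSUP_upper bounded_imp_bdd_above)
    then show ?thesis using zero[OF that(1)] by simp
  qed
  have "x = 0" if x: "x \<in> C" for x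
  proof (rule ccontr)
    assume "x \<noteq> 0"
    then obtain f where f: "f \<in> \<Gamma>" "blinfun_apply f x \<noteq> blinfun_apply f 0"
      using \<Gamma>(2) unfolding separates_points_def by blast
    moreover have "- f \<in> \<Gamma>" using \<Gamma>(1) f(1) by (simp add: symmetric_functionals_def)
    ultimately show False
      using le[of f x] le[of "- f" x] x by (simp add: blinfun.minus_left blinfun.zero_right)
  qed
  then show ?thesis using C by (auto simp: bdd_nonempty_sets_def)
qed

text \<open>This passes from the set-valued map to scalar measures: the criterion for
  \<open>{0}\<close> is applied to each measurable subset.\<close>

lemma null_sets_of_eq_common_null_ideal:
  assumes M: "M \<in> \<Sigma> \<rightarrow> bdd_nonempty_sets"
    and \<Gamma>: "symmetric_functionals \<Gamma>" "separates_points \<Gamma>"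
  shows "null_sets_of \<Sigma> M = {A\<in>\<Sigma>. \<forall>f\<in>\<Gamma>. A \<in> null_ideal \<Sigma> (support_map f M)}"
proof -
  have "M B = {0} \<longleftrightarrow> (\<forall>f\<in>\<Gamma>. support_map f M B = 0)" if "B \<in> \<Sigma>" for B
    using support_fun_zeros_imp_singleton_zero[OF funcset_mem[OF M that] \<Gamma>]
    by (metis support_map_def support_fun_singleton_zero)
  then show ?thesis
    by (auto simp: null_sets_of_def null_ideal_def cong: conj_cong)
qed

theorem theorem1:
  fixes \<Omega> :: "'a set" and \<Sigma> :: "'a set set"
    and M :: "'a set \<Rightarrow> 'b::banach set"
    and \<Gamma> :: "('b \<Rightarrow>\<^sub>L real) set"
  assumes "sigma_algebra \<Omega> \<Sigma>"
    and "M \<in> \<Sigma> \<rightarrow> bdd_nonempty_sets"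
    and "symmetric_functionals \<Gamma>"
    and "separates_points \<Gamma>"
    and "\<And>f. f \<in> \<Gamma> \<Longrightarrow> support_map f M \<in> ca \<Sigma>"
  shows "(\<exists>\<mu>. control_measure \<Sigma> M \<mu>) \<longleftrightarrow> ccc (\<Sigma> - null_sets_of \<Sigma> M)"
proof
  assume "\<exists>\<mu>. control_measure \<Sigma> M \<mu>"
  then obtain \<mu> where \<mu>: "\<mu> \<in> ca_pos \<Sigma>" "\<And>A. A \<in> \<Sigma> \<Longrightarrow> \<mu> A = 0 \<Longrightarrow> M A = {0}"
    by (auto simp: control_measure_def)
  \<comment> \<open>A set outside the null sets has a measurable subset \<open>B\<close> with
    \<open>M B \<noteq> {0}\<close>. By monotonicity \<open>\<mu> A = 0\<close> would give
    \<open>\<mu> B = 0\<close>, which the control property forbids.\<close>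
  have "\<mu> A \<noteq> 0" if A: "A \<in> \<Sigma> - null_sets_of \<Sigma> M" for A
  proof
    assume "\<mu> A = 0"
    obtain B where B: "B \<in> \<Sigma>" "B \<subseteq> A" "M B \<noteq> {0}"
      using A by (auto simp: null_sets_of_def)
    then have "\<mu> B \<le> 0" "0 \<le> \<mu> B"
      using ca_pos_mono[OF assms(1) \<mu>(1), of A B] A \<open>\<mu> A = 0\<close> \<mu>(1) by (auto simp: ca_pos_def)
    then show False using \<mu>(2) B by force
  qed
  then show "ccc (\<Sigma> - null_sets_of \<Sigma> M)"
    using ca_pos_disjoint_countable[OF assms(1) \<mu>(1)] unfolding ccc_def by (metis Diff_subset order_trans subsetD)
next
  assume ccc: "ccc (\<Sigma> - null_sets_of \<Sigma> M)"
  note null_eq = null_sets_of_eq_common_null_ideal[OF assms(2-4)]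
  have ideal: "sigma_ideal \<Sigma> (null_ideal \<Sigma> (support_map f M))" if "f \<in> \<Gamma>" for f
    using assms(5)[OF that] by (rule sigma_ideal_null_ideal[OF assms(1)])
  obtain \<Gamma>' where \<Gamma>': "countable \<Gamma>'" "\<Gamma>' \<subseteq> \<Gamma>"
    and common: "{A\<in>\<Sigma>. \<forall>f\<in>\<Gamma>'. A \<in> null_ideal \<Sigma> (support_map f M)} = null_sets_of \<Sigma> M"
    unfolding null_eq
    by (rule countable_subfamily_same_common_ideal[OF assms(1) ideal ccc[unfolded null_eq]])
      (assumption | rule that; assumption)+
  obtain \<mu> where \<mu>: "\<mu> \<in> ca_pos \<Sigma>"
    "\<And>A f. A \<in> \<Sigma> \<Longrightarrow> \<mu> A = 0 \<Longrightarrow> f \<in> \<Gamma>' \<Longrightarrow> A \<in> null_ideal \<Sigma> (support_map f M)"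
    using ca_countable_family_dominating[OF assms(1) \<Gamma>'(1), of "\<lambda>f. support_map f M"]
      assms(5) \<Gamma>'(2) by (metis subsetD)
  \<comment> \<open>A \<open>\<mu>\<close>-null set lies in the null ideals of all \<open>f\<close>
    in \<open>\<Gamma>'\<close>, which by \<open>common\<close> suffices for membership in
    \<open>null_sets_of \<Sigma> M\<close>; then take \<open>A\<close> as its own subset.\<close>
  have "M A = {0}" if A: "A \<in> \<Sigma>" "\<mu> A = 0" for A
  proof -
    have "A \<in> null_sets_of \<Sigma> M"
      unfolding common[symmetric] using \<mu>(2)[OF A] A(1) by blast
    then show ?thesis by (simp add: null_sets_of_def)
  qed
  then show "\<exists>\<mu>. control_measure \<Sigma> M \<mu>"
    using \<mu>(1) by (auto simp: control_measure_def)
qed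

end
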